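(* Let $H\in\mathbb{F}_q[x]$ and let $D_1,D_2$ be monic divisors of $H$. Then $$\phi(D_2)\,\eta\!\left(\frac{H}{D_2},D_1\right)=\phi(D_1)\,\eta\!\left(\frac{H}{D_1},D_2\right).$$
   Context: Let $\mathbb{F}_q$ be a finite field with $q$ elements and fix a non-trivial homomorphism $\lambda:(\mathbb{F}_q,+)\to\mathbb{C}^*$. For nonzero $M\in\mathbb{F}_q[x]$ of degree $m\ge1$ and $A\in\mathbb{F}_q[x]$, let $t_M(A)$ be the coefficient of $x^{m-1}$ in the remainder of $A$ on division by $M$ (if $m=0$, $t_M(A)=0$), and $E(G,M)(A)=\lambda(t_M(GA))$. For nonzero $D$, $\eta(G,D)=\sum_{R}E(G,D)(R)$, where $R$ runs over a complete residue system modulo $D$ with $\gcd(R,D)=1$. $|A|=q^{\deg A}$, and $\phi(D)=|D|\prod_{P}(1-|P|^{-1})$, the product over monic irreducible $P$ dividing $D$ (the number of polynomials of degree $<\deg D$ coprime to $D$). *)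

theory Defs
  imports Complex_Main "HOL-Library.Cardinality" "HOL-Computational_Algebra.Polynomial"
begin

definition nontrivial_add_char :: "('a::{finite,field} \<Rightarrow> complex) \<Rightarrow> bool" where
  "nontrivial_add_char \<psi> \<longleftrightarrow>
     (\<forall>a. \<psi> a \<noteq> 0) \<and> (\<forall>a b. \<psi> (a + b) = \<psi> a * \<psi> b) \<and> (\<exists>a. \<psi> a \<noteq> 1)"

definition tcoeff :: "'a::{finite,field} poly \<Rightarrow> 'a poly \<Rightarrow> 'a" where
  "tcoeff M A = (if degree M = 0 then 0 else coeff (A mod M) (degree M - 1))"

definition echar ::
    "('a::{finite,field} \<Rightarrow> complex) \<Rightarrow> 'a poly \<Rightarrow> 'a poly \<Rightarrow> 'a poly \<Rightarrow> complex" where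
  "echar \<psi> G M A = \<psi> (tcoeff M (G * A))"

text \<open>
  The sum runs over the standard complete residue system, consisting of the remainders modulo \<open>D\<close>.
  Lemma \<open>eta_complete_residue_system\<close> shows that every other complete residue system gives
  the same value.
\<close>

definition eta ::
    "('a::{finite,field} \<Rightarrow> complex) \<Rightarrow> 'a poly \<Rightarrow> 'a poly \<Rightarrow> complex" where
  "eta \<psi> G D = (\<Sum>R | R mod D = R \<and> coprime R D. echar \<psi> G D R)"

definition pnorm :: "'a::{finite,field} poly \<Rightarrow> real" where
  "pnorm A = (if A = 0 then 0 else real CARD('a) ^ degree A)"

definition pphi :: "'a::{finite,field} poly \<Rightarrow> real" where
  "pphi D = pnorm D *
     (\<Prod>P | lead_coeff P = 1 \<and> irreducible P \<and> P dvd D. 1 - inverse (pnorm P))"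

definition complete_residue_system :: "'a::{finite,field} poly \<Rightarrow> 'a poly set \<Rightarrow> bool" where
  "complete_residue_system D S \<longleftrightarrow> (\<forall>A. \<exists>!R. R \<in> S \<and> R mod D = A mod D)"

lemma eta_complete_residue_system:
  assumes "D \<noteq> 0" and "complete_residue_system D S"
  shows "eta \<psi> G D = (\<Sum>R | R \<in> S \<and> coprime R D. echar \<psi> G D R)"
proof -
  have inj: "inj_on (\<lambda>R. R mod D) {R. R \<in> S \<and> coprime R D}"
    using assms(2) unfolding complete_residue_system_def inj_on_def by blast
  have img: "(\<lambda>R. R mod D) ` {R. R \<in> S \<and> coprime R D} = {R. R mod D = R \<and> coprime R D}"
  proof (intro equalityI subsetI)
    fix A assume A: "A \<in> {R. R mod D = R \<and> coprime R D}"
    obtain R where R: "R \<in> S" "R mod D = A mod D"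
      using assms(2) unfolding complete_residue_system_def by blast
    with A assms(1) have "coprime R D"
      by (metis (mono_tags, lifting) coprime_mod_left_iff mem_Collect_eq)
    with A R show "A \<in> (\<lambda>R. R mod D) ` {R. R \<in> S \<and> coprime R D}"
      by (auto intro!: image_eqI[of _ _ R])
  qed (use assms(1) in auto)
  have eq: "echar \<psi> G D (R mod D) = echar \<psi> G D R" for R
    by (simp add: echar_def tcoeff_def mod_mult_right_eq)
  show ?thesis
    unfolding eta_def img[symmetric] sum.reindex[OF inj] by (simp add: eq)
qed

end

theory Submission
  imports Defs "HOL-Computational_Algebra.Polynomial_Factorial"
begin

text \<open>
  Write \<open>E(G, M)\<close> for \<open>echar \<psi> G M\<close>. Since \<open>t\<^bsub>MK\<^esub>(KA) = t\<^bsub>M\<^esub>(A)\<close> for monic \<open>K\<close>, both \<open>E(H/D\<^sub>2, D\<^sub>1)\<close> and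
  \<open>E(H/D\<^sub>1, D\<^sub>2)\<close> are the function \<open>E(H, D\<^sub>1D\<^sub>2)\<close>, which is therefore periodic modulo \<open>D\<^sub>1\<close> and modulo \<open>D\<^sub>2\<close>.
  The sum of a \<open>D\<close>-periodic function over the reduced residues modulo \<open>DK\<close> is \<open>\<phi>(DK)/\<phi>(D)\<close> times
  its sum over those modulo \<open>D\<close>, as one sees by adjoining the irreducible factors \<open>P\<close> of \<open>K\<close> one at a
  time: a lift \<open>S + DT\<close> of a reduced residue \<open>S\<close> modulo \<open>D\<close> is coprime to \<open>DP\<close> unless \<open>P\<close> divides it, which
  happens for no \<open>T\<close> modulo \<open>P\<close> if \<open>P\<close> divides \<open>D\<close>, and for exactly one otherwise. So both sides of the
  theorem are \<open>\<phi>(D\<^sub>1)\<phi>(D\<^sub>2)/\<phi>(D\<^sub>1D\<^sub>2)\<close> times \<open>\<eta>(H, D\<^sub>1D\<^sub>2)\<close>.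
\<close>

lemma irreducible_degree_pos:
  fixes P :: "'a::field poly"
  assumes "irreducible P"
  shows "degree P > 0"
  using assms irreducible_not_unit[OF assms]
  by (metis is_unit_iff_degree neq0_conv not_irreducible_zero)

lemma monic_irreducible_divisorE:
  fixes A :: "'a::field poly"
  assumes "degree A > 0"
  obtains P where "lead_coeff P = 1" and "irreducible P" and "P dvd A"
proof -
  have "A \<noteq> 0" using assms by auto
  then obtain F where prod_F: "\<Prod>\<^sub># F = smult (inverse (lead_coeff A)) A"
      and prime_F: "\<And>Q. Q \<in># F \<Longrightarrow> prime_elem Q"
    using field_poly_prod_mset_prime_factorization field_poly_in_prime_factorization_imp_prime
    by blast
  have "F \<noteq> {#}"
    using prod_F assms \<open>A \<noteq> 0\<close>
    by (metis degree_1 degree_smult_eq inverse_zero_imp_zero leading_coeff_0_iff less_irrefl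
        prod_mset_empty)
  then obtain Q where "Q \<in># F" by blast
  then have "irreducible Q" "Q dvd A"
    using prod_F prime_F \<open>A \<noteq> 0\<close> dvd_prod_mset[of Q F]
    by (auto simp: prime_elem_imp_irreducible dvd_smult_iff)
  then have "Q \<noteq> 0" by auto
  define P where "P = [:inverse (lead_coeff Q):] * Q"
  have unit_inverse: "is_unit [:inverse (lead_coeff Q):]"
    using \<open>Q \<noteq> 0\<close> by (simp add: is_unit_iff_degree)
  show thesis
  proof
    show "lead_coeff P = 1" using \<open>Q \<noteq> 0\<close> by (simp add: P_def)
    show "irreducible P"
      unfolding P_def using \<open>irreducible Q\<close> unit_inverse by (simp only: irreducible_mult_unit_left)
    show "P dvd A"
      unfolding P_def using \<open>Q dvd A\<close> unit_inverse by (simp only: mult_unit_dvd_iff')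
  qed
qed

lemma monic_degree_eq_0_iff:
  assumes "lead_coeff p = 1"
  shows "degree p = 0 \<longleftrightarrow> p = 1"
  using assms by (metis degree_1 degree_eq_zeroE lead_coeff_pCons(2) pCons_one)

lemma monic_poly_induct [consumes 1, case_names one mult]:
  fixes K :: "'a::field poly"
  assumes "lead_coeff K = 1"
    and one: "Q 1"
    and mult: "\<And>P K. lead_coeff P = 1 \<Longrightarrow> irreducible P \<Longrightarrow> lead_coeff K = 1 \<Longrightarrow> Q K \<Longrightarrow>
      Q (K * P)"
  shows "Q K"
  using assms(1)
proof (induction "degree K" arbitrary: K rule: less_induct)
  case less
  show ?case
  proof (cases "degree K = 0")
    case True
    then show ?thesis using one monic_degree_eq_0_iff[OF less.prems] by simp
  next
    case False
    then obtain P L where monic_irreducible: "lead_coeff P = 1" "irreducible P"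
        and K_eq: "K = L * P"
      using monic_irreducible_divisorE[of K] by (metis dvdE mult.commute neq0_conv)
    then have "lead_coeff L = 1" using less.prems by (simp add: lead_coeff_mult)
    have "P \<noteq> 0" "L \<noteq> 0" using monic_irreducible \<open>lead_coeff L = 1\<close> by auto
    then have "degree L < degree K"
      using irreducible_degree_pos[OF monic_irreducible(2)] by (simp add: K_eq degree_mult_eq)
    then show ?thesis
      using mult[OF monic_irreducible \<open>lead_coeff L = 1\<close> less.hyps] \<open>lead_coeff L = 1\<close>
      by (simp add: K_eq)
  qed
qed

lemma monic_irreducible_dvd_imp_eq:
  fixes P Q :: "'a::field poly"
  assumes "irreducible P" "irreducible Q" "lead_coeff P = 1" "lead_coeff Q = 1" "P dvd Q"
  shows "P = Q"
proof -
  obtain C where Q_eq: "Q = P * C" using assms(5) by (elim dvdE)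
  then have "is_unit C"
    using irreducibleD[OF assms(2)] irreducible_not_unit[OF assms(1)] by blast
  then have "degree C = 0" by (auto elim: is_unit_polyE)
  moreover have "lead_coeff C = 1" using assms(3,4) Q_eq by (simp add: lead_coeff_mult)
  ultimately show ?thesis using Q_eq by (simp add: monic_degree_eq_0_iff)
qed

lemma coprime_mult_prime_elem_iff:
  fixes a b p :: "'a::algebraic_semidom"
  assumes "prime_elem p"
  shows "coprime a (b * p) \<longleftrightarrow> coprime a b \<and> \<not> p dvd a"
proof
  assume "coprime a (b * p)"
  then show "coprime a b \<and> \<not> p dvd a"
    using assms by (meson coprime_common_divisor coprime_divisors dvd_refl dvd_triv_left
        dvd_triv_right prime_elem_not_unit)
next
  assume coprime_not_dvd: "coprime a b \<and> \<not> p dvd a"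
  show "coprime a (b * p)"
  proof (rule coprimeI)
    fix c assume "c dvd a" "c dvd b * p"
    then obtain d where bp_eq: "b * p = c * d" by (elim dvdE)
    have "\<not> p dvd c" using coprime_not_dvd \<open>c dvd a\<close> dvd_trans by blast
    then obtain e where "d = p * e"
      using prime_elem_dvd_multD[OF assms, of c d] bp_eq by (metis dvdE dvd_triv_right)
    then have "b = c * e"
      using bp_eq assms by (auto simp: mult.left_commute[of c] mult.commute[of b])
    then show "is_unit c" using coprime_not_dvd \<open>c dvd a\<close> coprime_common_divisor[of a b c] by simp
  qed
qed

definition residues :: "'a::semiring_modulo \<Rightarrow> 'a set" where
  "residues m = {r. r mod m = r}"

definition reduced_residues :: "'a::{semiring_modulo,algebraic_semidom} \<Rightarrow> 'a set" where
  "reduced_residues m = {r \<in> residues m. coprime r m}"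

lemma mem_residues_poly_iff:
  fixes D R :: "'a::field poly"
  assumes "D \<noteq> 0"
  shows "R \<in> residues D \<longleftrightarrow> (\<forall>i\<ge>degree D. coeff R i = 0)"
proof
  assume "R \<in> residues D"
  then show "\<forall>i\<ge>degree D. coeff R i = 0"
    using degree_mod_less[OF assms, of R] by (auto simp: residues_def intro: coeff_eq_0)
next
  assume "\<forall>i\<ge>degree D. coeff R i = 0"
  then have "R = 0 \<or> degree R < degree D"
    by (metis leading_coeff_0_iff not_less)
  then show "R \<in> residues D" by (auto simp: residues_def mod_poly_less)
qed

lemma bij_betw_Poly_residues:
  fixes D :: "'a::field poly"
  assumes "D \<noteq> 0"
  shows "bij_betw Poly {xs. length xs = degree D} (residues D)"
proof (rule bij_betw_byWitness[where f' = "\<lambda>R. map (coeff R) [0..<degree D]"])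
  show "\<forall>R\<in>residues D. Poly (map (coeff R) [0..<degree D]) = R"
    by (auto simp: mem_residues_poly_iff[OF assms] poly_eq_iff nth_default_def not_less)
qed (auto simp: mem_residues_poly_iff[OF assms] nth_default_def intro!: nth_equalityI)

lemma finite_residues:
  fixes D :: "'a::{finite,field} poly"
  assumes "D \<noteq> 0"
  shows "finite (residues D)"
  using bij_betw_finite[OF bij_betw_Poly_residues[OF assms]]
    finite_lists_length_eq[of "UNIV :: 'a set"] by simp

lemma card_residues:
  fixes D :: "'a::{finite,field} poly"
  assumes "D \<noteq> 0"
  shows "real (card (residues D)) = pnorm D"
  using bij_betw_same_card[OF bij_betw_Poly_residues[OF assms]]
    card_lists_length_eq[of "UNIV :: 'a set"] assms by (simp add: pnorm_def)

lemma bij_betw_mod_div_residues: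
  fixes D K :: "'a::field poly"
  assumes "D \<noteq> 0"
  shows "bij_betw (\<lambda>R. (R mod D, R div D)) (residues (D * K)) (residues D \<times> residues K)"
proof -
  have residues_mult: "R \<in> residues (D * K) \<longleftrightarrow> R div D \<in> residues K" for R
    by (simp add: residues_def mod_eq_self_iff_div_eq_0 poly_div_mult_right)
  have "(S + D * T) mod D = S" "(S + D * T) div D = T" if "S \<in> residues D" for S T
    using that assms by (simp_all add: residues_def mod_eq_self_iff_div_eq_0)
  then show ?thesis
    by (intro bij_betw_byWitness[where f' = "\<lambda>(S, T). S + D * T"])
      (auto simp: residues_mult, auto simp: residues_def)
qed

lemma bij_betw_mod_div_reduced_residues:
  fixes D P :: "'a::field poly"
  assumes "irreducible P" "D \<noteq> 0"
  shows "bij_betw (\<lambda>R. (R mod D, R div D)) (reduced_residues (D * P))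
    (SIGMA S:reduced_residues D. {T \<in> residues P. \<not> P dvd S + D * T})"
proof -
  have "coprime R (D * P) \<longleftrightarrow> coprime (R mod D) D \<and> \<not> P dvd R mod D + D * (R div D)" for R
    using assms by (simp add: coprime_mult_prime_elem_iff field_poly_irreducible_imp_prime)
  then have "bij_betw (\<lambda>R. (R mod D, R div D)) {R \<in> residues (D * P). coprime R (D * P)}
      {ST \<in> residues D \<times> residues P. case ST of (S, T) \<Rightarrow> coprime S D \<and> \<not> P dvd S + D * T}"
    by (intro bij_betw_Collect[OF bij_betw_mod_div_residues[OF assms(2)]]) simp
  also have "{ST \<in> residues D \<times> residues P. case ST of (S, T) \<Rightarrow> coprime S D \<and> \<not> P dvd S + D * T} =
      (SIGMA S:reduced_residues D. {T \<in> residues P. \<not> P dvd S + D * T})"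
    by (auto simp: reduced_residues_def)
  finally show ?thesis by (simp only: reduced_residues_def)
qed

lemma ex1_residue_prime_elem_dvd:
  fixes p a b :: "'a::euclidean_ring_cancel"
  assumes "prime_elem p" "\<not> p dvd b" "finite (residues p)"
  shows "\<exists>!t. t \<in> residues p \<and> p dvd a + b * t"
proof -
  let ?affine = "\<lambda>t. (a + b * t) mod p"
  have inj_affine: "inj_on ?affine (residues p)"
  proof (rule inj_onI)
    fix t u assume in_residues: "t \<in> residues p" "u \<in> residues p" and "?affine t = ?affine u"
    then have "p dvd b * (t - u)" by (simp add: mod_eq_dvd_iff algebra_simps)
    then have "t mod p = u mod p"
      using assms by (simp add: prime_elem_dvd_mult_iff mod_eq_dvd_iff)
    then show "t = u" using in_residues by (simp add: residues_def)
  qed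
  have "?affine ` residues p = residues p"
    using assms(3) by (rule endo_inj_surj[OF _ _ inj_affine]) (auto simp: residues_def)
  moreover have "0 \<in> residues p" by (simp add: residues_def)
  ultimately have "\<exists>!t. t \<in> residues p \<and> ?affine t = 0"
    using inj_affine by (metis (no_types, lifting) imageE inj_onD)
  then show ?thesis by (simp only: mod_eq_0_iff_dvd)
qed

lemma card_residues_not_dvd:
  fixes P D S :: "'a::{finite,field} poly"
  assumes "irreducible P" "coprime S D"
  shows "real (card {T \<in> residues P. \<not> P dvd S + D * T}) = pnorm P - of_bool (\<not> P dvd D)"
proof -
  have "P \<noteq> 0" using assms(1) by auto
  show ?thesis
  proof (cases "P dvd D")
    case True
    then have "\<not> P dvd S"
      using assms coprime_common_divisor irreducible_not_unit by blast
    then have "{T \<in> residues P. \<not> P dvd S + D * T} = residues P"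
      using True by (auto simp: dvd_add_left_iff)
    then show ?thesis using True card_residues[OF \<open>P \<noteq> 0\<close>] by simp
  next
    case False
    then obtain T where "T \<in> residues P" and
        "{T \<in> residues P. \<not> P dvd S + D * T} = residues P - {T}"
      using ex1_residue_prime_elem_dvd[OF field_poly_irreducible_imp_prime[OF assms(1)] False
          finite_residues[OF \<open>P \<noteq> 0\<close>], of S] by blast
    moreover from this(1) have "card (residues P) > 0"
      using finite_residues[OF \<open>P \<noteq> 0\<close>] by (auto simp: card_gt_0_iff)
    ultimately show ?thesis
      using False card_residues[OF \<open>P \<noteq> 0\<close>] by simp
  qed
qed

lemma sum_reduced_residues_mult_irreducible:
  fixes P D :: "'a::{finite,field} poly" and f :: "'a poly \<Rightarrow> 'b::real_vector"
  assumes "irreducible P" "D \<noteq> 0" and periodic: "\<And>R. f (R mod D) = f R"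
  shows "sum f (reduced_residues (D * P)) =
    (pnorm P - of_bool (\<not> P dvd D)) *\<^sub>R sum f (reduced_residues D)"
proof -
  let ?lifts = "\<lambda>S. {T \<in> residues P. \<not> P dvd S + D * T}"
  have "P \<noteq> 0" using assms(1) by auto
  then have finite_residue_sets: "finite (reduced_residues D)" "finite (?lifts S)" for S
    using assms(2) by (simp_all add: reduced_residues_def finite_residues)
  have "sum f (reduced_residues (D * P)) =
      (\<Sum>R\<in>reduced_residues (D * P). case (R mod D, R div D) of (S, T) \<Rightarrow> f S)"
    by (simp add: periodic)
  also have "\<dots> = (\<Sum>(S, T)\<in>Sigma (reduced_residues D) ?lifts. f S)"
    by (rule sum.reindex_bij_betw[OF bij_betw_mod_div_reduced_residues[OF assms(1,2)]])
  also have "\<dots> = (\<Sum>S\<in>reduced_residues D. real (card (?lifts S)) *\<^sub>R f S)"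
    using finite_residue_sets by (subst sum.Sigma[symmetric]) (simp_all add: sum_constant_scaleR)
  also have "\<dots> = (\<Sum>S\<in>reduced_residues D. (pnorm P - of_bool (\<not> P dvd D)) *\<^sub>R f S)"
    using assms(1) by (intro sum.cong) (simp_all add: card_residues_not_dvd reduced_residues_def)
  finally show ?thesis by (simp only: scaleR_sum_right)
qed

lemma pnorm_mult: "pnorm (A * B) = pnorm A * pnorm B"
  by (simp add: pnorm_def degree_mult_eq power_add)

lemma pnorm_irreducible_gt_1:
  fixes P :: "'a::{finite,field} poly"
  assumes "irreducible P"
  shows "pnorm P > 1"
proof -
  have "card {0, 1 :: 'a} \<le> CARD('a)" by (intro card_mono) auto
  moreover have "P \<noteq> 0" using assms by auto
  ultimately show ?thesis
    using irreducible_degree_pos[OF assms] by (simp add: pnorm_def one_less_power)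
qed

lemma finite_poly_divisors:
  fixes D :: "'a::{finite,field} poly"
  assumes "D \<noteq> 0"
  shows "finite {P. P dvd D}"
proof (rule finite_subset)
  show "{P. P dvd D} \<subseteq> residues (pCons 0 D)"
    using dvd_imp_degree_le[OF _ assms] assms
    by (auto simp: residues_def less_Suc_eq_le intro!: mod_poly_less)
qed (use assms in \<open>simp add: finite_residues\<close>)

lemma pphi_pos:
  fixes D :: "'a::{finite,field} poly"
  assumes "D \<noteq> 0"
  shows "pphi D > 0"
proof -
  have "1 - inverse (pnorm P) > 0" if "irreducible P" for P :: "'a poly"
    using pnorm_irreducible_gt_1[OF that] by (simp add: inverse_less_1_iff)
  then show ?thesis
    using assms by (auto simp: pphi_def pnorm_def intro!: mult_pos_pos prod_pos)
qed

lemma pphi_mult_irreducible: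
  fixes P D :: "'a::{finite,field} poly"
  assumes "lead_coeff P = 1" "irreducible P" "D \<noteq> 0"
  shows "pphi (D * P) = (pnorm P - of_bool (\<not> P dvd D)) * pphi D"
proof -
  let ?divisors = "\<lambda>D. {Q. lead_coeff Q = 1 \<and> irreducible Q \<and> Q dvd D}"
  have divisors_mult: "?divisors (D * P) = insert P (?divisors D)"
    using assms monic_irreducible_dvd_imp_eq[of _ P]
    by (auto simp: prime_elem_dvd_mult_iff field_poly_irreducible_imp_prime)
  show ?thesis
  proof (cases "P dvd D")
    case True
    then have "?divisors (D * P) = ?divisors D" using divisors_mult assms by auto
    then show ?thesis using True by (simp add: pphi_def pnorm_mult)
  next
    case False
    have "finite (?divisors D)"
      using finite_poly_divisors[OF assms(3)] by (rule finite_subset[rotated]) auto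
    then have "pphi (D * P) = pnorm P * (1 - inverse (pnorm P)) * pphi D"
      using False by (simp add: pphi_def pnorm_mult divisors_mult)
    also have "pnorm P * (1 - inverse (pnorm P)) = pnorm P - 1"
      using pnorm_irreducible_gt_1[OF assms(2)] by (simp add: field_simps)
    finally show ?thesis using False by simp
  qed
qed

lemma sum_reduced_residues_mult:
  fixes D K :: "'a::{finite,field} poly" and f :: "'a poly \<Rightarrow> 'b::real_vector"
  assumes "lead_coeff K = 1" "D \<noteq> 0" and periodic: "\<And>R. f (R mod D) = f R"
  shows "pphi D *\<^sub>R sum f (reduced_residues (D * K)) =
    pphi (D * K) *\<^sub>R sum f (reduced_residues D)"
  using assms(1)
proof (induction K rule: monic_poly_induct)
  case (mult P K)
  let ?factor = "pnorm P - of_bool (\<not> P dvd D * K)"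
  have nonzero: "D * K \<noteq> 0" using mult.hyps assms(2) by auto
  have "f (R mod (D * K)) = f R" for R
    by (metis periodic mod_mod_cancel dvd_triv_left)
  then have "pphi D *\<^sub>R sum f (reduced_residues (D * K * P)) =
      ?factor *\<^sub>R (pphi D *\<^sub>R sum f (reduced_residues (D * K)))"
    using sum_reduced_residues_mult_irreducible[OF mult.hyps(2) nonzero, of f]
    by (simp only: scaleR_left_commute)
  also have "\<dots> = pphi (D * K * P) *\<^sub>R sum f (reduced_residues D)"
    using pphi_mult_irreducible[OF mult.hyps(1,2) nonzero] by (simp only: mult.IH scaleR_scaleR)
  finally show ?case by (simp only: mult.assoc)
qed simp

lemma coeff_mult_add_of_degree_le:
  fixes p q :: "'a::comm_semiring_0 poly"
  assumes "degree p \<le> m" "degree q \<le> n"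
  shows "coeff (p * q) (m + n) = coeff p m * coeff q n"
proof (cases "degree p = m \<and> degree q = n")
  case True
  then show ?thesis using coeff_mult_degree_sum by blast
next
  case False
  then have "degree p < m \<or> degree q < n" using assms by auto
  moreover from this have "degree (p * q) < m + n"
    using degree_mult_le[of p q] assms by linarith
  ultimately show ?thesis by (auto simp: coeff_eq_0)
qed

lemma tcoeff_mult:
  fixes M K A :: "'a::{finite,field} poly"
  shows "tcoeff (M * K) (K * A) = lead_coeff K * tcoeff M A"
proof -
  have mod_mult: "(K * A) mod (M * K) = K * (A mod M)"
    by (simp only: mult.commute[of M] mult_mod_right)
  consider (zero) "M = 0 \<or> K = 0" | (unit) "is_unit M" "K \<noteq> 0"
    | (nonconstant) "degree M > 0" "K \<noteq> 0"
    using is_unit_iff_degree by blast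
  then show ?thesis
  proof cases
    case zero
    then show ?thesis by (auto simp: tcoeff_def)
  next
    case unit
    then have "A mod M = 0" by (simp add: mod_eq_0_iff_dvd unit_imp_dvd)
    then show ?thesis by (simp add: tcoeff_def mod_mult)
  next
    case nonconstant
    then have "degree (A mod M) \<le> degree M - 1"
      using degree_mod_less[of M A] by fastforce
    then have "coeff (K * (A mod M)) (degree K + (degree M - 1)) =
        lead_coeff K * coeff (A mod M) (degree M - 1)"
      by (intro coeff_mult_add_of_degree_le) simp_all
    moreover have "degree (M * K) - 1 = degree K + (degree M - 1)"
      using nonconstant by (subst degree_mult_eq) auto
    ultimately show ?thesis
      using nonconstant by (auto simp: tcoeff_def mod_mult degree_mult_eq_0)
  qed
qed

lemma echar_div:
  assumes "lead_coeff K = 1" "K dvd H"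
  shows "echar \<psi> (H div K) D = echar \<psi> H (D * K)"
proof
  fix R
  have "K * (H div K * R) = H * R" using assms(2) by (metis dvd_mult_div_cancel mult.assoc)
  then have "tcoeff (D * K) (H * R) = tcoeff D (H div K * R)"
    using tcoeff_mult[of D K "H div K * R"] by (simp only: assms(1) mult_1)
  then show "echar \<psi> (H div K) D R = echar \<psi> H (D * K) R" by (simp add: echar_def)
qed

lemma echar_mod: "echar \<psi> G D (R mod D) = echar \<psi> G D R"
  by (simp add: echar_def tcoeff_def mod_mult_right_eq)

lemma eta_eq_sum_reduced_residues: "eta \<psi> G D = sum (echar \<psi> G D) (reduced_residues D)"
  by (simp add: eta_def reduced_residues_def residues_def)

lemma pphi_mult_eta:
  assumes "lead_coeff K = 1" "K dvd H" "D \<noteq> 0"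
  shows "of_real (pphi D) * eta \<psi> H (D * K) = of_real (pphi (D * K)) * eta \<psi> (H div K) D"
  using sum_reduced_residues_mult[OF assms(1,3), of "echar \<psi> (H div K) D", OF echar_mod]
  by (simp add: eta_eq_sum_reduced_residues echar_div[OF assms(1,2)] scaleR_conv_of_real)

theorem theorem3p2:
  fixes \<psi> :: "'a::{finite,field} \<Rightarrow> complex" and H D\<^sub>1 D\<^sub>2 :: "'a poly"
  assumes "nontrivial_add_char \<psi>"
    and "lead_coeff D\<^sub>1 = 1" and "D\<^sub>1 dvd H"
    and "lead_coeff D\<^sub>2 = 1" and "D\<^sub>2 dvd H"
  shows "of_real (pphi D\<^sub>2) * eta \<psi> (H div D\<^sub>2) D\<^sub>1 = of_real (pphi D\<^sub>1) * eta \<psi> (H div D\<^sub>1) D\<^sub>2"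
proof -
  let ?\<phi> = "\<lambda>D. complex_of_real (pphi D)" and ?N = "D\<^sub>1 * D\<^sub>2"
  have nonzero: "D\<^sub>1 \<noteq> 0" "D\<^sub>2 \<noteq> 0" using assms by auto
  have "?\<phi> ?N * (?\<phi> D\<^sub>2 * eta \<psi> (H div D\<^sub>2) D\<^sub>1) = ?\<phi> D\<^sub>2 * (?\<phi> D\<^sub>1 * eta \<psi> H ?N)"
    using pphi_mult_eta[OF assms(4,5) nonzero(1), of \<psi>] by (simp only: mult.left_commute)
  also have "\<dots> = ?\<phi> D\<^sub>1 * (?\<phi> D\<^sub>2 * eta \<psi> H (D\<^sub>2 * D\<^sub>1))"
    by (simp only: mult.left_commute mult.commute[of D\<^sub>2])
  also have "\<dots> = ?\<phi> ?N * (?\<phi> D\<^sub>1 * eta \<psi> (H div D\<^sub>1) D\<^sub>2)"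
    using pphi_mult_eta[OF assms(2,3) nonzero(2), of \<psi>]
    by (simp only: mult.left_commute mult.commute[of D\<^sub>2])
  finally show ?thesis using pphi_pos[of ?N] nonzero by simp
qed

end
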